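(* Let $\mathcal{H}$ be an infinite dimensional quaternionic Hilbert space and let $T\in\mathcal{B}(\mathcal{H})$. Then the quaternionic essential numerical range $W_e(T)$ is a convex subset of $\mathbb{H}$.
   Context: $\mathbb{H}$ denotes the real quaternions, regarded as a 4-dimensional real vector space when speaking of convexity. $\mathcal{H}$ is an infinite dimensional two-sided Hilbert space over $\mathbb{H}$ with $\mathbb{H}$-valued inner product $\langle\cdot,\cdot\rangle$ (so $\langle x p, y q\rangle = q^*\langle x,y\rangle p$ and $\langle y,x\rangle=\langle x,y\rangle^*$ for $p,q\in\mathbb{H}$, where $q^*$ is the quaternionic conjugate) and norm $\|x\|=\sqrt{\langle x,x\rangle}$. $\mathcal{B}(\mathcal{H})$ is the space of bounded right $\mathbb{H}$-linear operators on $\mathcal{H}$ and $\mathcal{K}(\mathcal{H})$ is its closed ideal of compact operators. The (quaternionic) numerical range of $T$ is $W(T)=\{\langle Tx,x\rangle : x\in\mathcal{H},\ \|x\|=1\}\subseteq\mathbb{H}$, and the (quaternionic) essential numerical range is $W_e(T)=\bigcap_{K\in\mathcal{K}(\mathcal{H})}\overline{W(T+K)}$, where the bar denotes closure in $\mathbb{H}$. *)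

theory Defs
  imports "HOL-Analysis.Analysis"
begin

section \<open>The real quaternions\<close>

datatype quat = Quat (qre: real) (qi: real) (qj: real) (qk: real)

lemma quat_eqI:
  "\<lbrakk>qre p = qre q; qi p = qi q; qj p = qj q; qk p = qk q\<rbrakk> \<Longrightarrow> p = q"
  by (rule quat.expand) simp

lemma quat_eq_iff:
  "p = q \<longleftrightarrow> qre p = qre q \<and> qi p = qi q \<and> qj p = qj q \<and> qk p = qk q"
  by (auto intro: quat_eqI)

definition qcnj :: "quat \<Rightarrow> quat" where
  "qcnj q = Quat (qre q) (- qi q) (- qj q) (- qk q)"

instantiation quat :: ab_group_add
begin
definition zero_quat_def: "0 = Quat 0 0 0 0"
definition plus_quat_def: "p + q = Quat (qre p + qre q) (qi p + qi q) (qj p + qj q) (qk p + qk q)"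
definition uminus_quat_def: "- p = Quat (- qre p) (- qi p) (- qj p) (- qk p)"
definition minus_quat_def: "p - q = Quat (qre p - qre q) (qi p - qi q) (qj p - qj q) (qk p - qk q)"
instance
  by standard (simp_all add: zero_quat_def plus_quat_def uminus_quat_def minus_quat_def)
end

instantiation quat :: ring_1
begin
definition one_quat_def: "1 = Quat 1 0 0 0"
definition times_quat_def:
  "p * q = Quat
     (qre p * qre q - qi p * qi q - qj p * qj q - qk p * qk q)
     (qre p * qi q + qi p * qre q + qj p * qk q - qk p * qj q)
     (qre p * qj q - qi p * qk q + qj p * qre q + qk p * qi q)
     (qre p * qk q + qi p * qj q - qj p * qi q + qk p * qre q)"
instance
proof
  fix p q r :: quat
  show "p * q * r = p * (q * r)"
    by (simp add: times_quat_def quat_eq_iff algebra_simps)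
  show "(p + q) * r = p * r + q * r" "p * (q + r) = p * q + p * r"
    by (simp_all add: times_quat_def plus_quat_def quat_eq_iff algebra_simps)
  show "1 * p = p" "p * 1 = p"
    by (simp_all add: times_quat_def one_quat_def quat_eq_iff)
  show "(0::quat) \<noteq> 1"
    by (simp add: zero_quat_def one_quat_def)
qed
end

instantiation quat :: real_inner
begin
definition scaleR_quat_def: "r *\<^sub>R q = Quat (r * qre q) (r * qi q) (r * qj q) (r * qk q)"
definition inner_quat_def:
  "inner p q = qre p * qre q + qi p * qi q + qj p * qj q + qk p * qk q"
definition norm_quat_def: "norm (q :: quat) = sqrt (inner q q)"
definition dist_quat_def: "dist (p :: quat) q = norm (p - q)"
definition sgn_quat_def: "sgn (q :: quat) = inverse (norm q) *\<^sub>R q"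
definition uniformity_quat_def:
  "(uniformity :: (quat \<times> quat) filter) = (INF e\<in>{0<..}. principal {(x, y). dist x y < e})"
definition open_quat_def:
  "open (U :: quat set) \<longleftrightarrow> (\<forall>x\<in>U. \<forall>\<^sub>F (x', y) in uniformity. x' = x \<longrightarrow> y \<in> U)"
instance
proof
  fix x y z :: quat and a b :: real
  have nn: "inner x x \<ge> 0"
    by (simp add: inner_quat_def)
  show "inner x x \<ge> 0" by (fact nn)
  show "inner x x = 0 \<longleftrightarrow> x = 0"
  proof
    assume "inner x x = 0"
    then have "(qre x)\<^sup>2 + (qi x)\<^sup>2 + (qj x)\<^sup>2 + (qk x)\<^sup>2 = 0"
      by (simp add: inner_quat_def power2_eq_square)
    then have "(qre x)\<^sup>2 = 0 \<and> (qi x)\<^sup>2 = 0 \<and> (qj x)\<^sup>2 = 0 \<and> (qk x)\<^sup>2 = 0"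
      by (smt (verit) zero_le_power2)
    then show "x = 0"
      by (simp add: zero_quat_def quat_eq_iff)
  qed (simp add: inner_quat_def zero_quat_def)
  show "a *\<^sub>R (x + y) = a *\<^sub>R x + a *\<^sub>R y" "(a + b) *\<^sub>R x = a *\<^sub>R x + b *\<^sub>R x"
    "a *\<^sub>R b *\<^sub>R x = (a * b) *\<^sub>R x" "1 *\<^sub>R x = x"
    by (simp_all add: scaleR_quat_def plus_quat_def algebra_simps)
  show "inner x y = inner y x" "inner (x + y) z = inner x z + inner y z"
    "inner (a *\<^sub>R x) y = a * inner x y"
    by (simp_all add: inner_quat_def plus_quat_def scaleR_quat_def algebra_simps)
  show "norm x = sqrt (inner x x)" "dist x y = norm (x - y)" "sgn x = inverse (norm x) *\<^sub>R x"
    by (simp_all add: norm_quat_def dist_quat_def sgn_quat_def)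
  show "(uniformity :: (quat \<times> quat) filter) =
      (INF e\<in>{0<..}. principal {(x, y). dist x y < e})"
    by (fact uniformity_quat_def)
  show "open U \<longleftrightarrow> (\<forall>x\<in>U. \<forall>\<^sub>F (x', y) in uniformity. x' = x \<longrightarrow> y \<in> U)" for U :: "quat set"
    by (fact open_quat_def)
qed
end

instantiation quat :: real_normed_div_algebra
begin
definition inverse_quat_def: "inverse (q :: quat) = qcnj q /\<^sub>R inner q q"
definition divide_quat_def: "(p :: quat) div q = p * inverse q"
instance
proof
  fix x y :: quat and a :: real
  have sc: "(a *\<^sub>R x) * y = a *\<^sub>R (x * y)" "x * (a *\<^sub>R y) = a *\<^sub>R (x * y)" for a and x y :: quat
    by (simp_all add: scaleR_quat_def times_quat_def algebra_simps)
  show "(a *\<^sub>R x) * y = a *\<^sub>R (x * y)" "x * (a *\<^sub>R y) = a *\<^sub>R (x * y)"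
    by (fact sc)+
  have c: "qcnj x * x = inner x x *\<^sub>R 1" "x * qcnj x = inner x x *\<^sub>R 1" for x :: quat
    by (simp_all add: qcnj_def times_quat_def inner_quat_def scaleR_quat_def one_quat_def)
  show "inverse x * x = 1" "x * inverse x = 1" if "x \<noteq> 0"
    using that by (simp_all add: inverse_quat_def sc c)
  show "x div y = x * inverse y"
    by (fact divide_quat_def)
  show "inverse (0::quat) = 0"
    by (simp add: inverse_quat_def)
  have "inner (x * y) (x * y) = inner x x * inner y y"
    by (simp add: inner_quat_def times_quat_def algebra_simps)
  then show "norm (x * y) = norm x * norm y"
    by (simp add: norm_quat_def real_sqrt_mult)
qed
end

instantiation quat :: euclidean_space
begin
definition Basis_quat_def:
  "Basis = {Quat 1 0 0 0, Quat 0 1 0 0, Quat 0 0 1 0, Quat 0 0 0 1}"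
instance
proof
  fix x :: quat
  show "(Basis :: quat set) \<noteq> {}" "finite (Basis :: quat set)"
    by (simp_all add: Basis_quat_def)
  show "inner u v = (if u = v then 1 else 0)" if "u \<in> Basis" "v \<in> Basis" for u v :: quat
    using that unfolding Basis_quat_def inner_quat_def
    by (elim insertE emptyE) (simp_all only: quat.sel quat.inject, simp_all)
  show "(\<forall>u\<in>Basis. inner x u = 0) \<longleftrightarrow> x = 0"
    unfolding Basis_quat_def zero_quat_def by (cases x) (simp add: inner_quat_def)
qed
end

lemma DIM_quat [simp]: "DIM(quat) = 4"
  by (simp add: Basis_quat_def)


section \<open>Two-sided quaternionic Hilbert spaces\<close>

text \<open>
  Since \<open>real_inner\<close> comes with \<open>norm x = sqrt (inner x x)\<close>, the axiom \<open>inner_eq_qre_qinner\<close>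
  makes the norm \<open>sqrt \<langle>x, x\<rangle>\<close> (the value \<open>\<langle>x, x\<rangle>\<close> is real by \<open>qinner_cnj\<close>), and it makes
  \<open>\<langle>\<cdot>, \<cdot>\<rangle>\<close> positive definite.
  The inner product is right linear in its first argument and, by \<open>qinner_cnj\<close>, conjugate linear
  in the second.  The left multiplication is that of a bimodule; its interplay with the inner
  product is left unrestricted.
\<close>

class quaternionic_hilbert_space = real_inner + complete_space +
  fixes rmult :: "'a \<Rightarrow> quat \<Rightarrow> 'a"  (infixl "\<cdot>\<^sub>r" 75)
    and lmult :: "quat \<Rightarrow> 'a \<Rightarrow> 'a"  (infixr "\<cdot>\<^sub>l" 76)
    and qinner :: "'a \<Rightarrow> 'a \<Rightarrow> quat"
  assumes rmult_add_left: "(x + y) \<cdot>\<^sub>r p = x \<cdot>\<^sub>r p + y \<cdot>\<^sub>r p"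
    and rmult_add_right: "x \<cdot>\<^sub>r (p + q) = x \<cdot>\<^sub>r p + x \<cdot>\<^sub>r q"
    and rmult_assoc: "(x \<cdot>\<^sub>r p) \<cdot>\<^sub>r q = x \<cdot>\<^sub>r (p * q)"
    and rmult_of_real: "x \<cdot>\<^sub>r of_real r = r *\<^sub>R x"
    and lmult_add_right: "p \<cdot>\<^sub>l (x + y) = p \<cdot>\<^sub>l x + p \<cdot>\<^sub>l y"
    and lmult_add_left: "(p + q) \<cdot>\<^sub>l x = p \<cdot>\<^sub>l x + q \<cdot>\<^sub>l x"
    and lmult_assoc: "p \<cdot>\<^sub>l (q \<cdot>\<^sub>l x) = (p * q) \<cdot>\<^sub>l x"
    and lmult_one: "1 \<cdot>\<^sub>l x = x"
    and lmult_rmult: "(p \<cdot>\<^sub>l x) \<cdot>\<^sub>r q = p \<cdot>\<^sub>l (x \<cdot>\<^sub>r q)"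
    and qinner_add_left: "qinner (x + y) z = qinner x z + qinner y z"
    and qinner_rmult: "qinner (x \<cdot>\<^sub>r p) (y \<cdot>\<^sub>r q) = qcnj q * qinner x y * p"
    and qinner_cnj: "qinner y x = qcnj (qinner x y)"
    and inner_eq_qre_qinner: "inner x y = qre (qinner x y)"

definition rspan :: "'a::quaternionic_hilbert_space set \<Rightarrow> 'a set" where
  "rspan S = {\<Sum>a\<in>F. a \<cdot>\<^sub>r c a | F c. finite F \<and> F \<subseteq> S}"

text \<open>The type is passed as \<open>TYPE('a)\<close>, since the property concerns the whole space.\<close>

definition infinite_dimensional :: "'a::quaternionic_hilbert_space itself \<Rightarrow> bool" where
  "infinite_dimensional _ \<longleftrightarrow> (\<nexists>S :: 'a set. finite S \<and> rspan S = UNIV)"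


section \<open>Operators and numerical ranges\<close>

definition bounded_right_linear :: "('a::quaternionic_hilbert_space \<Rightarrow> 'a) \<Rightarrow> bool" where
  "bounded_right_linear T \<longleftrightarrow> bounded_linear T \<and> (\<forall>x q. T (x \<cdot>\<^sub>r q) = T x \<cdot>\<^sub>r q)"

definition compact_right_linear :: "('a::quaternionic_hilbert_space \<Rightarrow> 'a) \<Rightarrow> bool" where
  "compact_right_linear K \<longleftrightarrow> bounded_right_linear K \<and> compact (closure (K ` cball 0 1))"

definition numerical_range :: "('a::quaternionic_hilbert_space \<Rightarrow> 'a) \<Rightarrow> quat set" where
  "numerical_range T = {qinner (T x) x | x. norm x = 1}"

definition essential_numerical_range :: "('a::quaternionic_hilbert_space \<Rightarrow> 'a) \<Rightarrow> quat set" where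
  "essential_numerical_range T =
     (\<Inter>K\<in>{K. compact_right_linear K}. closure (numerical_range (\<lambda>x. T x + K x)))"

end

theory Submission
  imports Defs
begin

text \<open>
  Call \<open>q\<close> an asymptotic value of \<open>T\<close> if, for every finite set \<open>F\<close> of vectors, it is a limit of values
  \<open>\<langle>T x, x\<rangle>\<close> at unit vectors \<open>x\<close> orthogonal to \<open>F\<close>.  The proof shows that these values form a convex
  set and that this set is \<open>W\<^sub>e(T)\<close>.

  Convexity is easy although \<open>W(T)\<close> itself need not be convex.  After choosing \<open>x\<close> with
  \<open>\<langle>T x, x\<rangle>\<close> near \<open>p\<close>, one can choose \<open>y\<close> with \<open>\<langle>T y, y\<rangle>\<close> near \<open>q\<close> orthogonal to \<open>x\<close> and to any
  further finite set, and so make the cross terms \<open>\<langle>T x, y\<rangle>\<close> and \<open>\<langle>T y, x\<rangle>\<close> negligible.  Then the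
  unit vector \<open>\<surd>t x + \<surd>(1 - t) y\<close> has a value near \<open>t p + (1 - t) q\<close>
  (\<open>convex_asymptotic_values\<close>).

  Asymptotic values lie in \<open>W\<^sub>e(T)\<close> because a compact operator is almost invisible on the complement
  of a suitable finite set (\<open>compact_small_on_orthogonal_complement\<close>).

  The converse is where the quaternions matter.  If \<open>q\<close> is not an asymptotic value, the convexity just
  proved lets a real hyperplane separate \<open>q\<close> from the asymptotic values, and compactness of
  balls in \<open>\<real>\<^sup>4\<close> separates it already from the values on the unit vectors orthogonal to one finite set.
  The compression of \<open>T\<close> to the complement is completed to an operator on the whole space by a scalar
  \<open>r\<close> on the finite dimensional part, which changes \<open>T\<close> by a finite rank operator and turns
  the values into convex combinations of \<open>r\<close> and values of the compression
  (\<open>compact_perturbation_to_compression\<close>).  The scalar must be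
  real, since any other would act through all its conjugates \<open>c\<^sup>* r c\<close>, and it must lie on the
  right side of the hyperplane.  Both are possible because numerical ranges are invariant under
  conjugation by unit quaternions: the real part of a value is the mean of four of its conjugates.
  Infinite dimension enters here, since it provides a unit vector orthogonal to the finite set and
  hence a value to start from.
\<close>

section \<open>Quaternionic conjugation and the inner product\<close>

lemma qcnj_add: "qcnj (p + q) = qcnj p + qcnj q"
  by (simp add: qcnj_def plus_quat_def)

lemma qcnj_zero [simp]: "qcnj 0 = 0"
  by (simp add: qcnj_def zero_quat_def)

lemma qcnj_qcnj [simp]: "qcnj (qcnj q) = q"
  by (simp add: qcnj_def)

lemma norm_qcnj [simp]: "norm (qcnj q) = norm q"
  by (simp add: qcnj_def norm_quat_def inner_quat_def)

lemma of_real_quat: "of_real r = Quat r 0 0 0"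
  by (simp add: of_real_def one_quat_def scaleR_quat_def)

lemma qcnj_of_real [simp]: "qcnj (of_real r) = of_real r"
  by (simp add: of_real_quat qcnj_def)

lemma norm_quat_sq: "(norm (q::quat))\<^sup>2 = qre q * qre q + qi q * qi q + qj q * qj q + qk q * qk q"
  by (simp add: power2_norm_eq_inner inner_quat_def)

lemma mult_qcnj: "q * qcnj q = of_real ((norm q)\<^sup>2)"
  unfolding norm_quat_sq by (simp add: of_real_quat qcnj_def times_quat_def)

lemma qcnj_mult_self: "qcnj q * q = of_real ((norm q)\<^sup>2)"
  unfolding norm_quat_sq by (simp add: of_real_quat qcnj_def times_quat_def)

lemma of_real_commute_quat: "of_real r * (q::quat) = q * of_real r"
  by (simp add: of_real_quat times_quat_def mult.commute)

text \<open>
  Conjugating by the units \<open>1, i, j, k\<close> changes the signs of the imaginary coordinates so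
  that they cancel in the sum.
\<close>

lemma sum_unit_conjugates:
  "q + qcnj (Quat 0 1 0 0) * q * Quat 0 1 0 0 + qcnj (Quat 0 0 1 0) * q * Quat 0 0 1 0
     + qcnj (Quat 0 0 0 1) * q * Quat 0 0 0 1 = of_real (4 * qre q)"
  by (simp add: qcnj_def times_quat_def plus_quat_def of_real_quat)

lemma rmult_one: "x \<cdot>\<^sub>r 1 = (x::'a::quaternionic_hilbert_space)"
  using rmult_of_real[of x 1] by simp

lemma zero_rmult: "(0::'a::quaternionic_hilbert_space) \<cdot>\<^sub>r q = 0"
  using rmult_add_left[of "0::'a" 0 q] by simp

lemma rmult_diff_left:
  "(x - y) \<cdot>\<^sub>r q = x \<cdot>\<^sub>r q - (y::'a::quaternionic_hilbert_space) \<cdot>\<^sub>r q"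
  by (metis add_diff_cancel diff_add_cancel rmult_add_left)

lemma qinner_rmult_left:
  "qinner (x \<cdot>\<^sub>r p) (y::'a::quaternionic_hilbert_space) = qinner x y * p"
  using qinner_rmult[of x p y 1] of_real_1 qcnj_of_real[of 1] by (simp add: rmult_one)

lemma qinner_rmult_right:
  "qinner x ((y::'a::quaternionic_hilbert_space) \<cdot>\<^sub>r q) = qcnj q * qinner x y"
  using qinner_rmult[of x 1 y q] by (simp add: rmult_one)

lemma qinner_add_right:
  "qinner x (y + z) = qinner x y + qinner x (z::'a::quaternionic_hilbert_space)"
  by (metis qinner_add_left qinner_cnj qcnj_add)

lemma qinner_scaleR_left:
  "qinner (r *\<^sub>R x) (y::'a::quaternionic_hilbert_space) = of_real r * qinner x y"
  by (simp flip: rmult_of_real add: qinner_rmult_left of_real_commute_quat)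

lemma qinner_scaleR_right:
  "qinner x (r *\<^sub>R (y::'a::quaternionic_hilbert_space)) = of_real r * qinner x y"
  by (simp flip: rmult_of_real add: qinner_rmult_right)

lemma qinner_zero_left [simp]: "qinner 0 (y::'a::quaternionic_hilbert_space) = 0"
  using qinner_add_left[of 0 0 y] by simp

lemma qinner_zero_right [simp]: "qinner (y::'a::quaternionic_hilbert_space) 0 = 0"
  using qinner_add_right[of y 0 0] by simp

lemma qinner_diff_left:
  "qinner (x - y) (z::'a::quaternionic_hilbert_space) = qinner x z - qinner y z"
  by (metis add_diff_cancel diff_add_cancel qinner_add_left)

lemma qinner_diff_right:
  "qinner z (x - y) = qinner z x - qinner z (y::'a::quaternionic_hilbert_space)"
  by (metis add_diff_cancel diff_add_cancel qinner_add_right)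

lemma qinner_sum_left:
  "qinner (\<Sum>e\<in>E. g e) (z::'a::quaternionic_hilbert_space) = (\<Sum>e\<in>E. qinner (g e) z)"
  by (induction E rule: infinite_finite_induct) (simp_all add: qinner_add_left)

lemma qinner_sum_right:
  "qinner (z::'a::quaternionic_hilbert_space) (\<Sum>e\<in>E. g e) = (\<Sum>e\<in>E. qinner z (g e))"
  by (induction E rule: infinite_finite_induct) (simp_all add: qinner_add_right)

lemma qinner_eq_0_commute:
  "qinner x y = 0 \<longleftrightarrow> qinner y (x::'a::quaternionic_hilbert_space) = 0"
  by (metis qinner_cnj qcnj_zero)

lemma qinner_self: "qinner x x = of_real ((norm (x::'a::quaternionic_hilbert_space))\<^sup>2)"
proof -
  have "qcnj (qinner x x) = qinner x x"
    using qinner_cnj[of x x] by simp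
  then show ?thesis
    by (simp add: power2_norm_eq_inner inner_eq_qre_qinner qcnj_def of_real_quat quat_eq_iff)
qed

lemma norm_rmult: "norm (x \<cdot>\<^sub>r q) = norm (x::'a::quaternionic_hilbert_space) * norm q"
proof -
  have "(of_real ((norm (x \<cdot>\<^sub>r q))\<^sup>2) :: quat) = qcnj q * of_real ((norm x)\<^sup>2) * q"
    by (metis qinner_rmult qinner_self)
  also have "\<dots> = of_real ((norm x)\<^sup>2) * (qcnj q * q)"
    by (simp only: of_real_commute_quat[symmetric] mult.assoc)
  also have "\<dots> = of_real ((norm x * norm q)\<^sup>2)"
    by (simp add: qcnj_mult_self power_mult_distrib)
  finally have "(norm (x \<cdot>\<^sub>r q))\<^sup>2 = (norm x * norm q)\<^sup>2"
    by (simp only: of_real_eq_iff)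
  then show ?thesis
    by (simp add: power2_eq_iff_nonneg)
qed

text \<open>
  Rotating \<open>x\<close> by the conjugate of \<open>\<langle>x, y\<rangle>\<close> makes the quaternionic inner product real, which reduces
  the inequality to the real one.
\<close>

lemma norm_qinner_le: "norm (qinner x y) \<le> norm x * norm (y::'a::quaternionic_hilbert_space)"
proof (cases "qinner x y = 0")
  case False
  define c where "c = qinner x y"
  have "(norm c)\<^sup>2 = inner (x \<cdot>\<^sub>r qcnj c) y"
    by (simp add: inner_eq_qre_qinner qinner_rmult_left flip: c_def)
       (simp add: mult_qcnj of_real_quat del: of_real_power)
  also have "\<dots> \<le> norm x * norm c * norm y"
    using norm_cauchy_schwarz[of "x \<cdot>\<^sub>r qcnj c" y] by (simp add: norm_rmult)
  finally have "norm c * norm c \<le> norm c * (norm x * norm y)"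
    by (simp add: power2_eq_square mult_ac)
  then show ?thesis
    using False by (simp add: c_def)
qed simp

lemma bounded_linear_qinner_left:
  "bounded_linear (\<lambda>x. qinner x (y::'a::quaternionic_hilbert_space))"
  by (rule bounded_linear_intro[where K = "norm y"])
     (auto simp: qinner_add_left qinner_scaleR_left norm_qinner_le scaleR_conv_of_real)

lemma bounded_linear_rmult:
  "bounded_linear (\<lambda>p. (a::'a::quaternionic_hilbert_space) \<cdot>\<^sub>r p)"
proof (rule bounded_linear_intro[where K = "norm a"])
  show "a \<cdot>\<^sub>r (r *\<^sub>R p) = r *\<^sub>R (a \<cdot>\<^sub>r p)" for r p
    by (simp add: scaleR_conv_of_real of_real_commute_quat flip: rmult_of_real rmult_assoc)
qed (auto simp: rmult_add_right norm_rmult mult.commute)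

section \<open>Orthonormal sets and projections\<close>

definition qorthonormal :: "'a::quaternionic_hilbert_space set \<Rightarrow> bool" where
  "qorthonormal E \<longleftrightarrow> (\<forall>e\<in>E. \<forall>f\<in>E. qinner e f = (if e = f then 1 else 0))"

definition qproj :: "'a::quaternionic_hilbert_space set \<Rightarrow> 'a \<Rightarrow> 'a" where
  "qproj E x = (\<Sum>e\<in>E. e \<cdot>\<^sub>r qinner x e)"

lemma qinner_qproj:
  assumes "finite E" "qorthonormal E" "e \<in> E"
  shows "qinner (qproj E x) e = qinner x e"
proof -
  have "qinner (qproj E x) e = (\<Sum>f\<in>E. qinner f e * qinner x f)"
    by (simp add: qproj_def qinner_sum_left qinner_rmult_left)
  also have "\<dots> = (\<Sum>f\<in>E. if e = f then qinner x f else 0)"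
    using assms by (intro sum.cong) (auto simp: qorthonormal_def)
  finally show ?thesis
    using assms by simp
qed

lemma qinner_residual:
  assumes "finite E" "qorthonormal E" "e \<in> E"
  shows "qinner (x - qproj E x) e = 0"
  by (simp add: qinner_diff_left qinner_qproj[OF assms])

lemma qinner_qproj_orthogonal:
  assumes "\<forall>e\<in>E. qinner x e = 0"
  shows "qinner x (qproj E y) = 0"
  using assms by (simp add: qproj_def qinner_sum_right qinner_rmult_right)

lemma qinner_qproj_self_adjoint: "qinner (qproj E x) y = qinner x (qproj E y)"
proof -
  have "qinner (qproj E x) y = (\<Sum>e\<in>E. qinner e y * qinner x e)"
    by (simp add: qproj_def qinner_sum_left qinner_rmult_left)
  also have "\<dots> = (\<Sum>e\<in>E. qcnj (qinner y e) * qinner x e)"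
    by (simp flip: qinner_cnj)
  also have "\<dots> = qinner x (qproj E y)"
    by (simp add: qproj_def qinner_sum_right qinner_rmult_right)
  finally show ?thesis .
qed

lemma qproj_pythagoras:
  assumes "finite E" "qorthonormal E"
  shows "(norm x)\<^sup>2 = (norm (x - qproj E x))\<^sup>2 + (norm (qproj E x))\<^sup>2"
proof -
  have "inner (x - qproj E x) (qproj E x) = 0"
    using qinner_residual[OF assms] by (simp add: inner_eq_qre_qinner qinner_qproj_orthogonal zero_quat_def)
  then show ?thesis
    using norm_add_Pythagorean[of "x - qproj E x" "qproj E x"] by (simp add: orthogonal_def)
qed

lemma qinner_qproj_left_self:
  assumes "finite E" "qorthonormal E"
  shows "qinner (qproj E x) x = of_real ((norm (qproj E x))\<^sup>2)"
proof -
  have "qinner (x - qproj E x) (qproj E x) = 0"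
    using qinner_residual[OF assms] by (simp add: qinner_qproj_orthogonal)
  then have "qinner x (qproj E x) = qinner (qproj E x) (qproj E x)"
    by (simp add: qinner_diff_left)
  then show ?thesis
    by (simp add: qinner_qproj_self_adjoint[of E x x] qinner_self)
qed

lemma qproj_rmult: "qproj E (x \<cdot>\<^sub>r q) = qproj E x \<cdot>\<^sub>r q"
proof -
  have *: "(\<Sum>e\<in>E. g e) \<cdot>\<^sub>r q = (\<Sum>e\<in>E. g e \<cdot>\<^sub>r q)" for g :: "'a \<Rightarrow> 'a"
    by (induction E rule: infinite_finite_induct) (simp_all add: rmult_add_left zero_rmult)
  show ?thesis
    by (simp add: qproj_def * qinner_rmult_left rmult_assoc)
qed

lemma bounded_linear_qproj: "bounded_linear (qproj E)"
  unfolding qproj_def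
  by (intro bounded_linear_sum bounded_linear_compose[OF bounded_linear_rmult bounded_linear_qinner_left])

text \<open>The Gram-Schmidt process, recorded through orthogonal complements instead of spans.\<close>

lemma ex_qorthonormal_refining:
  assumes "finite (F :: 'a::quaternionic_hilbert_space set)"
  shows "\<exists>E. finite E \<and> qorthonormal E \<and>
           (\<forall>x. (\<forall>e\<in>E. qinner x e = 0) \<longrightarrow> (\<forall>f\<in>F. qinner x f = 0))"
  using assms
proof (induction F)
  case empty
  show ?case
    by (intro exI[of _ "{}"]) (auto simp: qorthonormal_def)
next
  case (insert z F)
  then obtain E where E: "finite E" "qorthonormal E"
    and EF: "\<And>x. \<forall>e\<in>E. qinner x e = 0 \<Longrightarrow> \<forall>f\<in>F. qinner x f = 0"
    by blast
  define y where "y = z - qproj E z"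
  have z: "qinner x z = qinner x y" if "\<forall>e\<in>E. qinner x e = 0" for x
    using qinner_qproj_orthogonal[OF that, of z] by (simp add: y_def qinner_diff_right)
  show ?case
  proof (cases "y = 0")
    case True
    then show ?thesis
      using E EF z by (intro exI[of _ E]) auto
  next
    case False
    define u where "u = inverse (norm y) *\<^sub>R y"
    have ue: "qinner u e = 0" if "e \<in> E" for e
      using qinner_residual[OF E that, of z] by (simp add: u_def qinner_scaleR_left y_def)
    have eu: "qinner e u = 0" if "e \<in> E" for e
      using ue[OF that] qinner_eq_0_commute by blast
    have "norm u = 1"
      using False by (simp add: u_def)
    then have uu: "qinner u u = 1"
      by (simp add: qinner_self)
    have "qorthonormal (insert u E)"
      using E(2) ue eu uu unfolding qorthonormal_def by force
    moreover have "qinner x z = 0" if "\<forall>e\<in>insert u E. qinner x e = 0" for x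
    proof -
      have "y = norm y *\<^sub>R u"
        using False by (simp add: u_def)
      then have "qinner x y = of_real (norm y) * qinner x u"
        by (metis qinner_scaleR_right)
      then show ?thesis
        using that z[of x] by simp
    qed
    ultimately show ?thesis
      using E EF by (intro exI[of _ "insert u E"]) auto
  qed
qed

lemma ex_unit_vector_orthogonal:
  assumes "infinite_dimensional TYPE('a::quaternionic_hilbert_space)" "finite (F :: 'a set)"
  shows "\<exists>x::'a. norm x = 1 \<and> (\<forall>f\<in>F. qinner x f = 0)"
proof -
  obtain E where E: "finite E" "qorthonormal E"
    and EF: "\<And>x. \<forall>e\<in>E. qinner x e = 0 \<Longrightarrow> \<forall>f\<in>F. qinner x f = 0"
    using ex_qorthonormal_refining[OF assms(2)] by blast
  obtain x where x: "x \<notin> rspan E"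
    using assms(1) E(1) unfolding infinite_dimensional_def by blast
  define y where "y = x - qproj E x"
  have "qproj E x \<in> rspan E"
    unfolding rspan_def qproj_def using E(1) by blast
  with x have "y \<noteq> 0"
    by (auto simp: y_def)
  have "\<forall>e\<in>E. qinner (inverse (norm y) *\<^sub>R y) e = 0"
    using qinner_residual[OF E] by (simp add: y_def qinner_scaleR_left)
  then show ?thesis
    using EF \<open>y \<noteq> 0\<close> by (intro exI[of _ "inverse (norm y) *\<^sub>R y"]) simp
qed

section \<open>Compact operators\<close>

lemma compact_closure_of_subset:
  assumes "X \<subseteq> C" "compact (C :: 'a::t2_space set)"
  shows "compact (closure X)"
proof -
  have "closure X \<subseteq> C"
    using assms by (simp add: closure_minimal compact_imp_closed)
  then show ?thesis
    using compact_Int_closed[OF assms(2) closed_closure, of X] by (simp add: inf_absorb2)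
qed

lemma compact_right_linear_add:
  assumes "compact_right_linear K" "compact_right_linear L"
  shows "compact_right_linear (\<lambda>x. K x + L x)"
proof -
  let ?A = "closure (K ` cball 0 1)" and ?B = "closure (L ` cball 0 1)"
  have c: "compact {x + y | x y. x \<in> ?A \<and> y \<in> ?B}"
    using assms by (intro compact_sums) (auto simp: compact_right_linear_def)
  have "(\<lambda>x. K x + L x) ` cball 0 1 \<subseteq> {x + y | x y. x \<in> ?A \<and> y \<in> ?B}"
    using closure_subset by blast
  then have "compact (closure ((\<lambda>x. K x + L x) ` cball 0 1))"
    using c by (rule compact_closure_of_subset)
  then show ?thesis
    using assms
    by (auto simp: compact_right_linear_def bounded_right_linear_def bounded_linear_add rmult_add_left)
qed

lemma compact_right_linear_rank_one:
  fixes a :: "'a::quaternionic_hilbert_space"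
  assumes "bounded_linear \<psi>" "\<And>x q. \<psi> (x \<cdot>\<^sub>r q) = \<psi> x * q"
  shows "compact_right_linear (\<lambda>x. a \<cdot>\<^sub>r \<psi> x)"
proof -
  have "bounded (\<psi> ` cball 0 1)"
    by (rule bounded_linear_image[OF bounded_cball assms(1)])
  then have "compact (closure (\<psi> ` cball 0 1))"
    by simp
  then have c: "compact ((\<lambda>p. a \<cdot>\<^sub>r p) ` closure (\<psi> ` cball 0 1))"
    by (intro compact_continuous_image linear_continuous_on bounded_linear_rmult)
  have "(\<lambda>x. a \<cdot>\<^sub>r \<psi> x) ` cball 0 1 \<subseteq> (\<lambda>p. a \<cdot>\<^sub>r p) ` closure (\<psi> ` cball 0 1)"
    using closure_subset by fastforce
  then have "compact (closure ((\<lambda>x. a \<cdot>\<^sub>r \<psi> x) ` cball 0 1))"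
    using c by (rule compact_closure_of_subset)
  then show ?thesis
    using bounded_linear_compose[OF bounded_linear_rmult assms(1)] assms(2)
    by (simp add: compact_right_linear_def bounded_right_linear_def rmult_assoc)
qed

lemma compact_right_linear_sum:
  fixes K :: "'a \<Rightarrow> 'b::quaternionic_hilbert_space \<Rightarrow> 'b"
  assumes "finite E" "\<And>e. e \<in> E \<Longrightarrow> compact_right_linear (K e)"
  shows "compact_right_linear (\<lambda>x. \<Sum>e\<in>E. K e x)"
  using assms
proof (induction E)
  case empty
  have "(\<lambda>x::'b. 0::'b) ` cball 0 1 \<subseteq> {0}"
    by auto
  then have "finite ((\<lambda>x::'b. 0::'b) ` cball 0 1)"
    using finite_subset by blast
  then show ?case
    by (simp add: compact_right_linear_def bounded_right_linear_def zero_rmult finite_imp_compact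
        finite_imp_closed closure_closed)
qed (simp add: compact_right_linear_add)

text \<open>
  A finite \<open>\<epsilon>\<close>-net of the image of the unit ball serves as \<open>F\<close>: a vector \<open>x\<close> orthogonal to the net
  only sees the distance from \<open>K x\<close> to the net.
\<close>

lemma compact_small_on_orthogonal_complement:
  fixes K :: "'a::quaternionic_hilbert_space \<Rightarrow> 'a"
  assumes "compact_right_linear K" "\<epsilon> > 0"
  shows "\<exists>F. finite F \<and> (\<forall>x. norm x = 1 \<longrightarrow> (\<forall>f\<in>F. qinner x f = 0) \<longrightarrow> norm (qinner (K x) x) < \<epsilon>)"
proof -
  obtain F where F: "finite F" "closure (K ` cball 0 1) \<subseteq> (\<Union>f\<in>F. ball f \<epsilon>)"
    using assms unfolding compact_right_linear_def compact_eq_totally_bounded by blast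
  have "norm (qinner (K x) x) < \<epsilon>" if x: "norm x = 1" "\<forall>f\<in>F. qinner x f = 0" for x
  proof -
    have "K x \<in> closure (K ` cball 0 1)"
      using x(1) closure_subset[of "K ` cball 0 1"] by auto
    then obtain f where f: "f \<in> F" "norm (K x - f) < \<epsilon>"
      using F(2) by (force simp: dist_norm norm_minus_commute)
    have "qinner f x = 0"
      using x(2) f(1) qinner_eq_0_commute by blast
    then have "qinner (K x) x = qinner (K x - f) x"
      by (simp add: qinner_diff_left)
    also have "norm \<dots> \<le> norm (K x - f)"
      using norm_qinner_le[of "K x - f" x] x(1) by simp
    finally show ?thesis
      using f(2) by simp
  qed
  with F(1) show ?thesis
    by blast
qed

text \<open>
  With \<open>P\<close> the projection and \<open>S = 1 - P\<close>, the operator \<open>K = S T S + r P - T\<close> replaces every block of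
  \<open>T\<close> except the compression to \<open>E\<^sup>\<bottom>\<close>.  Writing \<open>K = - P T S - T P + r P\<close> shows that it has finite rank.
\<close>

lemma compact_perturbation_to_compression:
  fixes T :: "'a::quaternionic_hilbert_space \<Rightarrow> 'a"
  assumes T: "bounded_right_linear T" and E: "finite E" "qorthonormal E"
  shows "\<exists>K. compact_right_linear K \<and>
    (\<forall>x. qinner (T x + K x) x = qinner (T (x - qproj E x)) (x - qproj E x)
           + of_real (r * (norm (qproj E x))\<^sup>2))"
proof -
  define S where "S = (\<lambda>x. x - qproj E x)"
  define K where "K = (\<lambda>x. \<Sum>e\<in>E. e \<cdot>\<^sub>r (- qinner (T (S x)) e) + (r *\<^sub>R e - T e) \<cdot>\<^sub>r qinner x e)"
  have Tb: "bounded_linear T" and Tr: "\<And>x q. T (x \<cdot>\<^sub>r q) = T x \<cdot>\<^sub>r q"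
    using T by (auto simp: bounded_right_linear_def)
  have Sb: "bounded_linear S"
    unfolding S_def by (intro bounded_linear_sub bounded_linear_ident bounded_linear_qproj)
  have Sr: "S (x \<cdot>\<^sub>r q) = S x \<cdot>\<^sub>r q" for x q
    by (simp add: S_def qproj_rmult rmult_diff_left)
  have "compact_right_linear K"
    unfolding K_def
  proof (intro compact_right_linear_sum[OF E(1)] compact_right_linear_add compact_right_linear_rank_one)
    fix e
    show "bounded_linear (\<lambda>x. - qinner (T (S x)) e)"
      by (intro bounded_linear_minus bounded_linear_compose[OF bounded_linear_qinner_left]
          bounded_linear_compose[OF Tb] Sb)
    show "bounded_linear (\<lambda>x. qinner x e)"
      by (rule bounded_linear_qinner_left)
  qed (simp_all add: Tr Sr qinner_rmult_left)
  moreover have "T x + K x = S (T (S x)) + r *\<^sub>R qproj E x" for x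
  proof -
    have m: "e \<cdot>\<^sub>r (- q) = - (e \<cdot>\<^sub>r q)" for e :: 'a and q
      by (rule linear_neg[OF bounded_linear.linear[OF bounded_linear_rmult]])
    have s: "(r *\<^sub>R e) \<cdot>\<^sub>r q = r *\<^sub>R (e \<cdot>\<^sub>r q)" for e :: 'a and q
      by (simp add: rmult_assoc of_real_commute_quat flip: rmult_of_real)
    have "T (qproj E x) = (\<Sum>e\<in>E. T e \<cdot>\<^sub>r qinner x e)"
      unfolding qproj_def by (simp add: linear_sum[OF bounded_linear.linear[OF Tb]] Tr)
    then have "K x = - qproj E (T (S x)) + (r *\<^sub>R qproj E x - T (qproj E x))"
      by (simp add: K_def qproj_def sum.distrib sum_subtractf sum_negf m rmult_diff_left s scaleR_sum_right)
    moreover have "T (S x) = T x - T (qproj E x)"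
      by (simp add: S_def linear_diff[OF bounded_linear.linear[OF Tb]])
    moreover have "S (T (S x)) = T (S x) - qproj E (T (S x))"
      by (simp add: S_def)
    ultimately show ?thesis
      by simp
  qed
  moreover have "qinner (S y) x = qinner y (S x)" for x y
    by (simp add: S_def qinner_diff_left qinner_diff_right qinner_qproj_self_adjoint)
  ultimately show ?thesis
    by (intro exI[of _ K])
       (simp add: qinner_add_left qinner_scaleR_left qinner_qproj_left_self[OF E] S_def)
qed

section \<open>Asymptotic values\<close>

definition orthogonal_range :: "('a::quaternionic_hilbert_space \<Rightarrow> 'a) \<Rightarrow> 'a set \<Rightarrow> quat set" where
  "orthogonal_range T F = {qinner (T x) x | x. norm x = 1 \<and> (\<forall>f\<in>F. qinner x f = 0)}"

definition asymptotic_values :: "('a::quaternionic_hilbert_space \<Rightarrow> 'a) \<Rightarrow> quat set" where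
  "asymptotic_values T = (\<Inter>F\<in>{F. finite F}. closure (orthogonal_range T F))"

lemma orthogonal_range_antimono: "F \<subseteq> G \<Longrightarrow> orthogonal_range T G \<subseteq> orthogonal_range T F"
  unfolding orthogonal_range_def by blast

lemma orthogonal_range_conjugate:
  assumes "bounded_right_linear T" "w \<in> orthogonal_range T F" "norm p = 1"
  shows "qcnj p * w * p \<in> orthogonal_range T F"
proof -
  obtain x where x: "w = qinner (T x) x" "norm x = 1" "\<forall>f\<in>F. qinner x f = 0"
    using assms(2) unfolding orthogonal_range_def by blast
  have "qcnj p * w * p = qinner (T (x \<cdot>\<^sub>r p)) (x \<cdot>\<^sub>r p)"
    using assms(1) x(1) by (simp add: bounded_right_linear_def qinner_rmult)
  then show ?thesis
    unfolding orthogonal_range_def using x assms(3)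
    by (intro CollectI exI[of _ "x \<cdot>\<^sub>r p"]) (simp add: norm_rmult qinner_rmult_left)
qed

text \<open>
  The range need not contain the real part of its element \<open>w\<close>, but it contains the four
  conjugates of \<open>w\<close> whose mean is that real part, and a half-space is convex.
\<close>

lemma half_space_contains_real_part:
  assumes "bounded_right_linear T" "w \<in> orthogonal_range T F"
    and "\<forall>v\<in>orthogonal_range T F. b \<le> inner a v"
  shows "b \<le> inner a (of_real (qre w))"
proof -
  have "b \<le> inner a (qcnj p * w * p)" if "norm p = 1" for p
    using orthogonal_range_conjugate[OF assms(1,2) that] assms(3) by blast
  then have "b \<le> inner a (qcnj (Quat 0 1 0 0) * w * Quat 0 1 0 0)"
    "b \<le> inner a (qcnj (Quat 0 0 1 0) * w * Quat 0 0 1 0)"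
    "b \<le> inner a (qcnj (Quat 0 0 0 1) * w * Quat 0 0 0 1)"
    by (simp_all add: norm_quat_def inner_quat_def)
  moreover have "b \<le> inner a w"
    using assms by blast
  ultimately have "4 * b \<le> inner a (of_real (4 * qre w))"
    unfolding sum_unit_conjugates[symmetric] inner_add_right by linarith
  also have "\<dots> = 4 * inner a (of_real (qre w))"
    by (simp add: of_real_def)
  finally show ?thesis
    by simp
qed

text \<open>
  This replaces orthogonality to the adjoint vector \<open>T\<^sup>* x\<close>.  Let \<open>z\<close> be a unit vector at which
  \<open>\<phi> = \<langle>T \<cdot>, x\<rangle>\<close> nearly attains its norm \<open>s\<close>.  For a unit vector \<open>y\<close> orthogonal to \<open>z\<close>, evaluating \<open>\<phi>\<close> at
  \<open>z \<phi>(z)\<^sup>* + y \<phi>(y)\<^sup>*\<close> gives \<open>|\<phi>(z)|\<^sup>2 + |\<phi>(y)|\<^sup>2 \<le> s\<^sup>2\<close>, so \<open>\<phi>(y)\<close> is small.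
\<close>

lemma ex_almost_representing_vector:
  fixes T :: "'a::quaternionic_hilbert_space \<Rightarrow> 'a"
  assumes T: "bounded_right_linear T" and "\<epsilon> > 0"
  shows "\<exists>z. \<forall>y. norm y = 1 \<longrightarrow> qinner y z = 0 \<longrightarrow> norm (qinner (T y) x) \<le> \<epsilon>"
proof (cases "\<exists>u::'a. norm u = 1")
  case False
  then show ?thesis
    by blast
next
  case True
  then obtain u :: 'a where u: "norm u = 1" ..
  define \<phi> where "\<phi> = (\<lambda>y. qinner (T y) x)"
  have lin: "bounded_linear \<phi>"
    unfolding \<phi>_def using T
    by (intro bounded_linear_compose[OF bounded_linear_qinner_left]) (simp add: bounded_right_linear_def)
  have right: "\<phi> (y \<cdot>\<^sub>r q) = \<phi> y * q" for y q
    using T by (simp add: \<phi>_def bounded_right_linear_def qinner_rmult_left)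
  define A where "A = (\<lambda>y. norm (\<phi> y)) ` {y. norm y = 1}"
  define s where "s = Sup A"
  obtain B where B: "\<And>y. norm (\<phi> y) \<le> norm y * B"
    using bounded_linear.bounded[OF lin] by blast
  have bdd: "bdd_above A"
    unfolding A_def using B by (intro bdd_aboveI2[where M = B]) (metis mem_Collect_eq mult_1)
  have ne: "A \<noteq> {}"
    unfolding A_def using u by blast
  have s1: "norm (\<phi> y) \<le> s" if "norm y = 1" for y
    unfolding s_def using that bdd by (intro cSup_upper) (auto simp: A_def)
  have s: "norm (\<phi> y) \<le> s * norm y" for y
  proof (cases "y = 0")
    case True
    then show ?thesis
      using linear_0[OF bounded_linear.linear[OF lin]] by simp
  next
    case False
    have "norm (\<phi> (inverse (norm y) *\<^sub>R y)) \<le> s"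
      using False by (intro s1) simp
    then show ?thesis
      using False by (simp add: linear_scale[OF bounded_linear.linear[OF lin]] field_simps)
  qed
  have s0: "s \<ge> 0"
    using s1[OF u] norm_ge_zero order_trans by blast
  \<comment> \<open>The deficit is chosen so that \<open>s\<^sup>2 - |\<phi>(z)|\<^sup>2 \<le> 2 s \<delta> \<le> \<epsilon>\<^sup>2\<close>.\<close>
  define \<delta> where "\<delta> = \<epsilon>\<^sup>2 / (2 * (s + 1))"
  have d: "\<delta> > 0" "2 * s * \<delta> \<le> \<epsilon>\<^sup>2"
    using s0 \<open>\<epsilon> > 0\<close> by (simp_all add: \<delta>_def field_simps)
  obtain z where z: "norm z = 1" "s - \<delta> < norm (\<phi> z)"
    using less_cSup_iff[OF ne bdd, of "s - \<delta>"] d(1) by (auto simp: s_def A_def)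
  have "norm (\<phi> y) \<le> \<epsilon>" if y: "norm y = 1" "qinner y z = 0" for y
  proof -
    define v where "v = z \<cdot>\<^sub>r qcnj (\<phi> z) + y \<cdot>\<^sub>r qcnj (\<phi> y)"
    define m where "m = (norm (\<phi> z))\<^sup>2 + (norm (\<phi> y))\<^sup>2"
    have m0: "m \<ge> 0"
      by (simp add: m_def)
    have "inner (z \<cdot>\<^sub>r qcnj (\<phi> z)) (y \<cdot>\<^sub>r qcnj (\<phi> y)) = 0"
      using y(2) qinner_eq_0_commute[of y z] by (simp add: inner_eq_qre_qinner qinner_rmult zero_quat_def[symmetric])
         (simp add: zero_quat_def)
    then have nv: "(norm v)\<^sup>2 = m"
      using norm_add_Pythagorean[of "z \<cdot>\<^sub>r qcnj (\<phi> z)" "y \<cdot>\<^sub>r qcnj (\<phi> y)"] y(1) z(1)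
      by (simp add: v_def m_def norm_rmult orthogonal_def)
    have "\<phi> v = of_real m"
      by (simp add: v_def m_def linear_add[OF bounded_linear.linear[OF lin]] right mult_qcnj
          del: of_real_power)
    then have "m \<le> s * norm v"
      using s[of v] m0 by simp
    then have "m\<^sup>2 \<le> s\<^sup>2 * m"
      using power_mono[OF _ m0, of "s * norm v" 2] by (simp add: power_mult_distrib nv)
    then have "m \<le> s\<^sup>2"
      using m0 by (cases "m = 0") (auto simp: power2_eq_square)
    moreover have "s\<^sup>2 - (norm (\<phi> z))\<^sup>2 \<le> \<epsilon>\<^sup>2"
    proof -
      have "s\<^sup>2 - (norm (\<phi> z))\<^sup>2 = (s - norm (\<phi> z)) * (s + norm (\<phi> z))"
        by (simp add: power2_eq_square algebra_simps)
      also have "\<dots> \<le> \<delta> * (2 * s)"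
        using z s1[OF z(1)] s0 d(1) by (intro mult_mono) auto
      finally show ?thesis
        using d(2) by (simp add: mult_ac)
    qed
    ultimately have "(norm (\<phi> y))\<^sup>2 \<le> \<epsilon>\<^sup>2"
      by (simp add: m_def)
    then show ?thesis
      using \<open>\<epsilon> > 0\<close> by (simp add: power2_le_iff_abs_le)
  qed
  then show ?thesis
    unfolding \<phi>_def by blast
qed

lemma qinner_combination:
  fixes T :: "'a::quaternionic_hilbert_space \<Rightarrow> 'a"
  assumes "bounded_right_linear T"
  shows "qinner (T (a *\<^sub>R x + b *\<^sub>R y)) (a *\<^sub>R x + b *\<^sub>R y) =
    a\<^sup>2 *\<^sub>R qinner (T x) x + b\<^sup>2 *\<^sub>R qinner (T y) y + (a * b) *\<^sub>R (qinner (T x) y + qinner (T y) x)"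
proof -
  have "linear T"
    using assms by (simp add: bounded_right_linear_def bounded_linear.linear)
  then have "T (a *\<^sub>R x + b *\<^sub>R y) = a *\<^sub>R T x + b *\<^sub>R T y"
    by (simp add: linear_add linear_scale)
  then show ?thesis
    by (simp add: qinner_add_left qinner_add_right qinner_scaleR_left qinner_scaleR_right
        flip: scaleR_conv_of_real)
       (simp add: power2_eq_square algebra_simps)
qed

text \<open>
  Orthogonality of \<open>y\<close> to \<open>x\<close> keeps the combination a unit vector, orthogonality to \<open>T x\<close> removes one cross
  term, and orthogonality to the almost representing vector \<open>z\<close> makes the other one small.
\<close>

lemma convex_asymptotic_values:
  fixes T :: "'a::quaternionic_hilbert_space \<Rightarrow> 'a"
  assumes T: "bounded_right_linear T"
  shows "convex (asymptotic_values T)"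
proof (rule convexI)
  fix p q :: quat and s t :: real
  assume p: "p \<in> asymptotic_values T" and q: "q \<in> asymptotic_values T"
    and st: "0 \<le> s" "0 \<le> t" "s + t = 1"
  have "s *\<^sub>R p + t *\<^sub>R q \<in> closure (orthogonal_range T F)" if F: "finite F" for F
    unfolding closure_approachable
  proof (intro allI impI)
    fix e :: real
    assume "e > 0"
    define \<epsilon> where "\<epsilon> = e / 3"
    have e: "\<epsilon> > 0"
      using \<open>e > 0\<close> by (simp add: \<epsilon>_def)
    have "\<exists>w\<in>orthogonal_range T F. dist w p < \<epsilon>"
      using p F e by (simp add: asymptotic_values_def closure_approachable)
    then obtain x where x: "norm x = 1" "\<forall>f\<in>F. qinner x f = 0" "norm (qinner (T x) x - p) < \<epsilon>"
      by (auto simp: orthogonal_range_def dist_norm)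
    obtain z where z: "\<And>y. norm y = 1 \<Longrightarrow> qinner y z = 0 \<Longrightarrow> norm (qinner (T y) x) \<le> \<epsilon>"
      using ex_almost_representing_vector[OF T e, of x] by blast
    have "\<exists>w\<in>orthogonal_range T (F \<union> {x, T x, z}). dist w q < \<epsilon>"
      using q F e by (simp add: asymptotic_values_def closure_approachable)
    then obtain y where y: "norm y = 1" "\<forall>f\<in>F \<union> {x, T x, z}. qinner y f = 0"
        "norm (qinner (T y) y - q) < \<epsilon>"
      by (auto simp: orthogonal_range_def dist_norm)
    define v where "v = sqrt s *\<^sub>R x + sqrt t *\<^sub>R y"
    have "qinner x y = 0" "qinner (T x) y = 0"
      using y(2) qinner_eq_0_commute by blast+
    then have "inner x y = 0"
      by (simp add: inner_eq_qre_qinner zero_quat_def)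
    then have "(norm v)\<^sup>2 = 1"
      using norm_add_Pythagorean[of "sqrt s *\<^sub>R x" "sqrt t *\<^sub>R y"] st x(1) y(1)
      by (simp add: v_def orthogonal_def power_mult_distrib)
    then have "norm v = 1"
      by (metis norm_ge_zero one_power2 power2_eq_imp_eq zero_le_one)
    moreover have "\<forall>f\<in>F. qinner v f = 0"
      using x(2) y(2) by (simp add: v_def qinner_add_left qinner_scaleR_left)
    ultimately have v: "qinner (T v) v \<in> orthogonal_range T F"
      unfolding orthogonal_range_def by blast
    have "qinner (T v) v - (s *\<^sub>R p + t *\<^sub>R q) =
        s *\<^sub>R (qinner (T x) x - p) + t *\<^sub>R (qinner (T y) y - q) + sqrt (s * t) *\<^sub>R qinner (T y) x"
      unfolding v_def qinner_combination[OF T] using \<open>qinner (T x) y = 0\<close> st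
      by (simp add: real_sqrt_mult algebra_simps)
    also have "norm \<dots> \<le> s * \<epsilon> + t * \<epsilon> + 1 * \<epsilon>"
    proof (intro norm_triangle_mono)
      show "norm (s *\<^sub>R (qinner (T x) x - p)) \<le> s * \<epsilon>"
        using x(3) st(1) by (simp add: mult_left_mono)
      show "norm (t *\<^sub>R (qinner (T y) y - q)) \<le> t * \<epsilon>"
        using y(3) st(2) by (simp add: mult_left_mono)
      have "s * t \<le> 1"
        using st by (intro mult_le_one) auto
      moreover have "norm (qinner (T y) x) \<le> \<epsilon>"
        using y by (intro z) auto
      ultimately show "norm (sqrt (s * t) *\<^sub>R qinner (T y) x) \<le> 1 * \<epsilon>"
        unfolding norm_scaleR using st by (intro mult_mono) auto
    qed
    also have "\<dots> = 2 * \<epsilon>"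
      using st(3) by (simp flip: distrib_right)
    also have "\<dots> < e"
      using \<open>e > 0\<close> by (simp add: \<epsilon>_def)
    finally show "\<exists>w\<in>orthogonal_range T F. dist w (s *\<^sub>R p + t *\<^sub>R q) < e"
      using v by (auto simp: dist_norm)
  qed
  then show "s *\<^sub>R p + t *\<^sub>R q \<in> asymptotic_values T"
    by (simp add: asymptotic_values_def)
qed

text \<open>
  The closures of the orthogonal ranges form a directed family of compact sets, so one of them already
  avoids a closed set that their intersection avoids.
\<close>

lemma orthogonal_range_avoids_closed:
  fixes T :: "'a::quaternionic_hilbert_space \<Rightarrow> 'a"
  assumes T: "bounded_right_linear T" and "closed C" "asymptotic_values T \<inter> C = {}"
  shows "\<exists>F. finite F \<and> orthogonal_range T F \<inter> C = {}"
proof (rule ccontr)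
  assume "\<not> ?thesis"
  then have meets: "orthogonal_range T F \<inter> C \<noteq> {}" if "finite F" for F
    using that by blast
  obtain B where B: "\<And>x. norm (T x) \<le> norm x * B"
    using T bounded_linear.bounded unfolding bounded_right_linear_def by blast
  have sub: "orthogonal_range T F \<subseteq> cball 0 B" for F
  proof
    fix w
    assume "w \<in> orthogonal_range T F"
    then obtain x where x: "w = qinner (T x) x" "norm x = 1"
      by (auto simp: orthogonal_range_def)
    then show "w \<in> cball 0 B"
      using norm_qinner_le[of "T x" x] B[of x] by simp
  qed
  have "(cball 0 B \<inter> C) \<inter> \<Inter>((\<lambda>F. closure (orthogonal_range T F)) ` {F. finite F}) \<noteq> {}"
  proof (rule compact_imp_fip)
    show "compact (cball 0 B \<inter> C)"
      using \<open>closed C\<close> by (intro compact_Int_closed) auto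
    fix \<F>
    assume "finite \<F>" "\<F> \<subseteq> (\<lambda>F. closure (orthogonal_range T F)) ` {F. finite F}"
    then obtain G where G: "finite G" "G \<subseteq> {F. finite F}"
        "\<F> = (\<lambda>F. closure (orthogonal_range T F)) ` G"
      by (meson finite_subset_image)
    then have "finite (\<Union>G)"
      by blast
    then obtain w where w: "w \<in> orthogonal_range T (\<Union>G)" "w \<in> C"
      using meets by blast
    have "w \<in> closure (orthogonal_range T F)" if "F \<in> G" for F
      using w(1) orthogonal_range_antimono[of F "\<Union>G" T] that closure_subset by blast
    then show "(cball 0 B \<inter> C) \<inter> \<Inter>\<F> \<noteq> {}"
      using w sub G(3) by blast
  qed auto
  then show False
    using assms(3) by (auto simp: asymptotic_values_def)
qed

lemma asymptotic_values_subset_essential: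
  fixes T :: "'a::quaternionic_hilbert_space \<Rightarrow> 'a"
  shows "asymptotic_values T \<subseteq> essential_numerical_range T"
proof
  fix q
  assume q: "q \<in> asymptotic_values T"
  have "q \<in> closure (numerical_range (\<lambda>x. T x + K x))" if K: "compact_right_linear K" for K
    unfolding closure_approachable
  proof (intro allI impI)
    fix e :: real
    assume "e > 0"
    then obtain F where F: "finite F"
      "\<And>x. norm x = 1 \<Longrightarrow> \<forall>f\<in>F. qinner x f = 0 \<Longrightarrow> norm (qinner (K x) x) < e / 2"
      using compact_small_on_orthogonal_complement[OF K, of "e / 2"] by auto
    have "\<exists>w\<in>orthogonal_range T F. dist w q < e / 2"
      using q F(1) \<open>e > 0\<close> by (simp add: asymptotic_values_def closure_approachable del: less_divide_eq_numeral1)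
    then obtain x where x: "norm x = 1" "\<forall>f\<in>F. qinner x f = 0" "norm (qinner (T x) x - q) < e / 2"
      by (auto simp: orthogonal_range_def dist_norm)
    have "qinner (T x + K x) x - q = (qinner (T x) x - q) + qinner (K x) x"
      by (simp add: qinner_add_left)
    also have "norm \<dots> < e"
      using norm_triangle_lt[of "qinner (T x) x - q" "qinner (K x) x" e] x F(2)[OF x(1,2)] by simp
    finally show "\<exists>w\<in>numerical_range (\<lambda>x. T x + K x). dist w q < e"
      using x(1) by (auto simp: numerical_range_def dist_norm)
  qed
  then show "q \<in> essential_numerical_range T"
    by (simp add: essential_numerical_range_def)
qed

text \<open>
  The perturbation \<open>K\<close> built below depends on \<open>q\<close>: it moves the whole numerical range of \<open>T + K\<close> to the side
  of the hyperplane that does not contain \<open>q\<close>.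
\<close>

lemma essential_subset_asymptotic_values:
  fixes T :: "'a::quaternionic_hilbert_space \<Rightarrow> 'a"
  assumes inf: "infinite_dimensional TYPE('a)" and T: "bounded_right_linear T"
  shows "essential_numerical_range T \<subseteq> asymptotic_values T"
proof (rule ccontr)
  assume "\<not> ?thesis"
  then obtain q where q: "q \<in> essential_numerical_range T" "q \<notin> asymptotic_values T"
    by blast
  have "closed (asymptotic_values T)"
    by (auto simp: asymptotic_values_def)
  then obtain a b where ab: "inner a q < b" "\<forall>v\<in>asymptotic_values T. inner a v > b"
    using separating_hyperplane_closed_point[OF convex_asymptotic_values[OF T]] q(2) by blast
  obtain F where F: "finite F" "orthogonal_range T F \<inter> {v. inner a v \<le> b} = {}"
    using orthogonal_range_avoids_closed[OF T closed_halfspace_le[of a b]] ab(2) by force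
  obtain E where E: "finite E" "qorthonormal E"
    and EF: "\<And>x. \<forall>e\<in>E. qinner x e = 0 \<Longrightarrow> \<forall>f\<in>F. qinner x f = 0"
    using ex_qorthonormal_refining[OF F(1)] by blast
  have above: "\<forall>v\<in>orthogonal_range T F. b \<le> inner a v"
    using F(2) by force
  obtain w where w: "w \<in> orthogonal_range T F"
    using ex_unit_vector_orthogonal[OF inf F(1)] by (auto simp: orthogonal_range_def)
  define r where "r = qre w"
  have r: "b \<le> inner a (of_real r)"
    unfolding r_def by (rule half_space_contains_real_part[OF T w above])
  obtain K where K: "compact_right_linear K" and
    val: "\<And>x. qinner (T x + K x) x = qinner (T (x - qproj E x)) (x - qproj E x)
           + of_real (r * (norm (qproj E x))\<^sup>2)"
    using compact_perturbation_to_compression[OF T E, of r] by blast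
  have "b \<le> inner a (qinner (T x + K x) x)" if x: "norm x = 1" for x
  proof -
    define y where "y = x - qproj E x"
    define c where "c = norm y"
    have "\<forall>f\<in>F. qinner y f = 0"
      using EF qinner_residual[OF E] by (simp add: y_def)
    have y: "b * c\<^sup>2 \<le> inner a (qinner (T y) y)"
    proof (cases "y = 0")
      case True
      then show ?thesis
        by (simp add: c_def)
    next
      case False
      define u where "u = inverse c *\<^sub>R y"
      have "norm u = 1" "\<forall>f\<in>F. qinner u f = 0"
        using False \<open>\<forall>f\<in>F. qinner y f = 0\<close> by (simp_all add: u_def c_def qinner_scaleR_left)
      then have "b \<le> inner a (qinner (T u) u)"
        using above by (auto simp: orthogonal_range_def)
      moreover have "y = c *\<^sub>R u"
        using False by (simp add: u_def c_def)
      then have "qinner (T y) y = c\<^sup>2 *\<^sub>R qinner (T u) u"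
        using qinner_combination[OF T, of c u 0 u] by simp
      ultimately show ?thesis
        by (simp add: mult.commute[of b] mult_left_mono)
    qed
    have "inner a (of_real (r * (norm (qproj E x))\<^sup>2)) = (norm (qproj E x))\<^sup>2 * inner a (of_real r)"
      by (simp add: of_real_def)
    also have "\<dots> \<ge> (norm (qproj E x))\<^sup>2 * b"
      using r by (intro mult_left_mono) auto
    finally have "b * c\<^sup>2 + (norm (qproj E x))\<^sup>2 * b \<le> inner a (qinner (T x + K x) x)"
      using y unfolding val inner_add_right y_def[symmetric] by linarith
    moreover have "c\<^sup>2 + (norm (qproj E x))\<^sup>2 = 1"
      using qproj_pythagoras[OF E, of x] x by (simp add: c_def y_def)
    then have "b * c\<^sup>2 + (norm (qproj E x))\<^sup>2 * b = b"
      by (metis distrib_left mult.commute mult.right_neutral)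
    ultimately show ?thesis
      by simp
  qed
  then have "numerical_range (\<lambda>x. T x + K x) \<subseteq> {v. b \<le> inner a v}"
    by (auto simp: numerical_range_def)
  then have "closure (numerical_range (\<lambda>x. T x + K x)) \<subseteq> {v. b \<le> inner a v}"
    by (intro closure_minimal closed_halfspace_ge[of b a, simplified])
  moreover have "q \<in> closure (numerical_range (\<lambda>x. T x + K x))"
    using q(1) K by (simp add: essential_numerical_range_def)
  ultimately show False
    using ab(1) by auto
qed

theorem theorem3p2:
  fixes T :: "'a::quaternionic_hilbert_space \<Rightarrow> 'a"
  assumes "infinite_dimensional TYPE('a)"
    and "bounded_right_linear T"
  shows "convex (essential_numerical_range T)"
proof -
  have "essential_numerical_range T = asymptotic_values T"
    using essential_subset_asymptotic_values[OF assms] asymptotic_values_subset_essential by blast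
  then show ?thesis
    using convex_asymptotic_values[OF assms(2)] by simp
qed

end
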